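(* Let $1<p<\infty$, let $n\ge 1$, let $(\Omega,\mathbb{F},\mu)$ be a $\sigma$-finite measure space, and let $\mathbf{U}=(U_1,\dots,U_n)$ be a tuple of pairwise commuting linear isometries (not necessarily onto) on $L^p(\Omega,\mathbb{F},\mu)$. Let $w=(w_{i_1,\dots,i_n})_{(i_1,\dots,i_n)\in\mathbb{N}^n}$ be a family of positive real numbers such that: (1) $w_{i_1,\dots,i_n}\geq 1$ for all $(i_1,\dots,i_n)\in\mathbb{N}^n$; (2) for each $1\leq j\leq n$, the quantity $M_j:=\sup_{(i_1,\dots,i_n)\in\mathbb{N}^n}\frac{w_{i_1,\dots,i_j+1,\dots,i_n}}{w_{i_1,\dots,i_j,\dots,i_n}}$ is finite. Then for every complex polynomial $P$ in $n$ variables, $$\|P(U_1,\dots,U_n)\|_{L^p(\Omega,\mathbb{F},\mu)\to L^p(\Omega,\mathbb{F},\mu)}\leq \|P(R_1,\dots,R_n)\|_{\ell^{p}(w,\mathbb{N}^n)\to \ell^{p}(w,\mathbb{N}^n)},$$ where $R_1,\dots,R_n$ are the right shift operators on $\ell^p(w,\mathbb{N}^n)$.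
   Context: Here $\mathbb{N}=\{1,2,3,\dots\}$ and all $L^p$-spaces are complex. For a family $w=(w_{i_1,\dots,i_n})$ of positive reals indexed by $\mathbb{N}^n$, $\ell^p(w,\mathbb{N}^n)$ is the Banach space of complex families $x=(x_{i_1,\dots,i_n})_{(i_1,\dots,i_n)\in\mathbb{N}^n}$ with $\|x\|=\big(\sum_{(i_1,\dots,i_n)\in\mathbb{N}^n}|x_{i_1,\dots,i_n}|^p\,w_{i_1,\dots,i_n}\big)^{1/p}<\infty$. For $1\le j\le n$, the $j$-th right shift $R_j$ is defined by $(R_jx)_{i_1,\dots,i_j,\dots,i_n}=0$ if $i_j=1$ and $(R_jx)_{i_1,\dots,i_j,\dots,i_n}=x_{i_1,\dots,i_j-1,\dots,i_n}$ if $i_j>1$. The norms are operator norms. *)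

theory Defs
  imports "HOL-Analysis.Analysis" "HOL-Library.Poly_Mapping"
begin

text \<open>
  Elements of \<open>L\<^sup>p(M)\<close> are represented by functions, equality in \<open>L\<^sup>p(M)\<close> being equality
  almost everywhere.
\<close>

definition Lp_space :: "real \<Rightarrow> 'a measure \<Rightarrow> ('a \<Rightarrow> complex) set" where
  "Lp_space p M = {f \<in> borel_measurable M. integrable M (\<lambda>x. norm (f x) powr p)}"

definition Lp_norm :: "real \<Rightarrow> 'a measure \<Rightarrow> ('a \<Rightarrow> complex) \<Rightarrow> real" where
  "Lp_norm p M f = (\<integral>x. norm (f x) powr p \<partial>M) powr (1 / p)"

text \<open>
  The second conjunct says that \<open>U\<close> descends to a map on the almost-everywhere classes.
\<close>

definition Lp_linear_isometry ::
    "real \<Rightarrow> 'a measure \<Rightarrow> (('a \<Rightarrow> complex) \<Rightarrow> ('a \<Rightarrow> complex)) \<Rightarrow> bool" where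
  "Lp_linear_isometry p M U \<longleftrightarrow>
     (\<forall>f\<in>Lp_space p M. U f \<in> Lp_space p M) \<and>
     (\<forall>f\<in>Lp_space p M. \<forall>g\<in>Lp_space p M.
        (AE x in M. f x = g x) \<longrightarrow> (AE x in M. U f x = U g x)) \<and>
     (\<forall>f\<in>Lp_space p M. \<forall>g\<in>Lp_space p M.
        AE x in M. U (\<lambda>y. f y + g y) x = U f x + U g x) \<and>
     (\<forall>c. \<forall>f\<in>Lp_space p M. AE x in M. U (\<lambda>y. c * f y) x = c * U f x) \<and>
     (\<forall>f\<in>Lp_space p M. Lp_norm p M (U f) = Lp_norm p M f)"

definition Lp_commute ::
    "real \<Rightarrow> 'a measure \<Rightarrow> (('a \<Rightarrow> complex) \<Rightarrow> ('a \<Rightarrow> complex)) \<Rightarrow>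
     (('a \<Rightarrow> complex) \<Rightarrow> ('a \<Rightarrow> complex)) \<Rightarrow> bool" where
  "Lp_commute p M U V \<longleftrightarrow> (\<forall>f\<in>Lp_space p M. AE x in M. U (V f) x = V (U f) x)"

text \<open>
  The index set \<open>\<nat>\<^sup>n\<close> with \<open>\<nat> = {1, 2, \<dots>}\<close>; the coordinates are numbered from 1 to \<open>n\<close>.
\<close>

definition multi_index :: "nat \<Rightarrow> (nat \<Rightarrow> nat) set" where
  "multi_index n = (\<Pi>\<^sub>E j\<in>{1..n}. {1..})"

text \<open>
  A family indexed by \<^term>\<open>multi_index n\<close> is a function that vanishes off
  \<^term>\<open>multi_index n\<close>, so that equality of families is equality of functions.
\<close>

definition wlp_space ::
    "real \<Rightarrow> nat \<Rightarrow> ((nat \<Rightarrow> nat) \<Rightarrow> real) \<Rightarrow> ((nat \<Rightarrow> nat) \<Rightarrow> complex) set" where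
  "wlp_space p n w =
     {x. (\<forall>i. i \<notin> multi_index n \<longrightarrow> x i = 0) \<and>
         (\<lambda>i. norm (x i) powr p * w i) summable_on multi_index n}"

definition wlp_norm ::
    "real \<Rightarrow> nat \<Rightarrow> ((nat \<Rightarrow> nat) \<Rightarrow> real) \<Rightarrow> ((nat \<Rightarrow> nat) \<Rightarrow> complex) \<Rightarrow> real" where
  "wlp_norm p n w x = (\<Sum>\<^sub>\<infinity>i\<in>multi_index n. norm (x i) powr p * w i) powr (1 / p)"

definition right_shift ::
    "nat \<Rightarrow> nat \<Rightarrow> ((nat \<Rightarrow> nat) \<Rightarrow> complex) \<Rightarrow> ((nat \<Rightarrow> nat) \<Rightarrow> complex)" where
  "right_shift n j x =
     (\<lambda>i. if i \<in> multi_index n \<and> i j > 1 then x (i(j := i j - 1)) else 0)"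

text \<open>
  A polynomial is a finitely supported map from exponent vectors to coefficients; it is a
  polynomial in \<open>n\<close> variables if only the variables with indices 1 to \<open>n\<close> occur in it.
\<close>

type_synonym cmpoly = "(nat \<Rightarrow>\<^sub>0 nat) \<Rightarrow>\<^sub>0 complex"

definition poly_in_vars :: "nat \<Rightarrow> cmpoly \<Rightarrow> bool" where
  "poly_in_vars n P \<longleftrightarrow>
     (\<forall>m\<in>Poly_Mapping.keys P. Poly_Mapping.keys m \<subseteq> {1..n})"

text \<open>
  \<open>T\<^sub>1\<^bsup>m\<^sub>1\<^esup> \<circ> \<dots> \<circ> T\<^sub>n\<^bsup>m\<^sub>n\<^esup>\<close>; the order of the factors is immaterial for commuting operators.
\<close>

definition monom_op ::
    "nat \<Rightarrow> (nat \<Rightarrow> 'v \<Rightarrow> 'v) \<Rightarrow> (nat \<Rightarrow>\<^sub>0 nat) \<Rightarrow> 'v \<Rightarrow> 'v" where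
  "monom_op n T m =
     foldr (\<lambda>j S. (T j ^^ Poly_Mapping.lookup m j) \<circ> S) [1..<Suc n] id"

definition poly_op ::
    "nat \<Rightarrow> (nat \<Rightarrow> ('b \<Rightarrow> complex) \<Rightarrow> ('b \<Rightarrow> complex)) \<Rightarrow> cmpoly \<Rightarrow>
     ('b \<Rightarrow> complex) \<Rightarrow> ('b \<Rightarrow> complex)" where
  "poly_op n T P f =
     (\<lambda>x. \<Sum>m\<in>Poly_Mapping.keys P. Poly_Mapping.lookup P m * monom_op n T m f x)"

text \<open>
  Operator norm with respect to the norm \<open>N\<close> on the space with carrier \<open>V\<close>. It takes values in
  the extended reals, so that it is \<open>\<infinity>\<close> for an unbounded operator.
\<close>

definition op_norm :: "'v set \<Rightarrow> ('v \<Rightarrow> real) \<Rightarrow> ('v \<Rightarrow> 'v) \<Rightarrow> ereal" where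
  "op_norm V N T = (SUP x\<in>{x \<in> V. N x \<le> 1}. ereal (N (T x)))"

end

theory Submission
  imports Defs "HOL-Real_Asymp.Real_Asymp"
begin

text \<open>
  Let \<open>C\<close> be the norm of \<open>P(R)\<close>, and write \<open>U^e\<close> for the product of the powers \<open>U\<^sub>j^(e\<^sub>j)\<close>. The proof
  intertwines \<open>P(R)\<close> with \<open>P(U)\<close>: if \<open>A\<close> sends a finitely supported family \<open>X\<close> of elements of
  \<open>L\<^sup>p\<close> to the sum of all \<open>U^i X\<^sub>i\<close>, then \<open>A R\<^sub>j = U\<^sub>j A\<close>, and hence \<open>A P(R) = P(U) A\<close>. By Hoelder's
  inequality, on families supported in a cube the norm of \<open>A\<close> with respect to the weight \<open>w\<close> is at
  most \<open>S powr ((p-1)/p)\<close>, where \<open>S\<close> is the sum of \<open>v = w powr (-1/(p-1))\<close> over the cube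
  (\<open>weighted_Hoelder_powr\<close>).

  For \<open>f\<close> in \<open>L\<^sup>p\<close>, the family \<open>X\<^sub>i = v\<^sub>i U^(N-i) f\<close> on the cube of side \<open>N\<close> is the equality case of
  Hoelder's inequality, up to isometries: \<open>A X = S\<^sub>N U^N f\<close>, and the \<open>p\<close>-th power of the weighted norm
  of \<open>X\<close> is \<open>S\<^sub>N\<close> times that of the norm of \<open>f\<close>. The family \<open>P(R) X\<close> is supported in the cube of
  side \<open>N + d\<close>, where \<open>d\<close> bounds the exponents in \<open>P\<close>. Since scalar inequalities for \<open>P(R)\<close> may be
  integrated over the measure space, \<open>A P(R) X = S\<^sub>N U^N P(U) f\<close> implies, for the \<open>p\<close>-th powers of the
  norms, \<open>S\<^sub>N^p \<parallel>P(U) f\<parallel>^p \<le> S\<^sub>N\<^sub>+\<^sub>d^(p-1) C^p S\<^sub>N \<parallel>f\<parallel>^p\<close>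
  (\<open>poly_op_transference_estimate\<close>).

  It remains to find \<open>N\<close> for which \<open>S\<^sub>N\<^sub>+\<^sub>d / S\<^sub>N\<close> is as close to 1 as desired. As \<open>w \<ge> 1\<close>, one has
  \<open>v \<le> 1\<close>, so \<open>S\<^sub>N \<le> N^n\<close> grows at most polynomially, and this ratio cannot stay above a constant
  larger than 1 (\<open>polynomially_bounded_slow_growth\<close>). The oscillation of \<open>w\<close> within
  the cube is absorbed by the coefficients \<open>v\<close> of \<open>X\<close>, so this ratio is the only loss.
\<close>

section \<open>Two real inequalities\<close>

text \<open>
  At the endpoint 0, convexity reduces to \<open>t powr p \<le> t\<close> for \<open>t\<close> between 0 and 1.
\<close>

lemma powr_convex_nonneg:
  assumes "1 \<le> p"
  shows "convex_on {0..} (\<lambda>x::real. x powr p)"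
  unfolding convex_on_def
proof (intro conjI ballI allI impI)
  fix x y u v :: real
  assume *: "x \<in> {0..}" "y \<in> {0..}" "0 \<le> u" "0 \<le> v" "u + v = 1"
  have scale: "(t * z) powr p \<le> t * z powr p" if "0 \<le> t" "t \<le> 1" "0 \<le> z" for t z :: real
  proof -
    have "t powr p \<le> t"
      using powr_mono'[of 1 p t] that assms by simp
    then show ?thesis
      using that by (simp add: powr_mult mult_right_mono)
  qed
  consider "x = 0" | "y = 0" | "x > 0" "y > 0"
    using * by fastforce
  then show "(u *\<^sub>R x + v *\<^sub>R y) powr p \<le> u * x powr p + v * y powr p"
  proof cases
    case 3
    then show ?thesis
      using powr_convex[OF assms] * unfolding convex_on_def by simp
  qed (use * scale[of u x] scale[of v y] in auto)
qed simp

text \<open>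
  This is Hoelder's inequality for the factorisation of \<open>z i\<close> as
  \<open>w i powr (-1/p) * (w i powr (1/p) * z i)\<close>. With \<open>v = w powr (-1/(p-1))\<close> and \<open>S\<close> the sum of
  \<open>v\<close> over \<open>B\<close>, it is Jensen's inequality for the probability weights \<open>v i / S\<close> at the points
  \<open>S * norm (z i) / v i\<close>, because \<open>v powr (1 - p) = w\<close>.
\<close>

lemma weighted_Hoelder_powr:
  fixes z :: "'i \<Rightarrow> complex" and w :: "'i \<Rightarrow> real"
  assumes "1 < p" "finite B" "\<And>i. i \<in> B \<Longrightarrow> 0 < w i"
  shows "norm (\<Sum>i\<in>B. z i) powr p
           \<le> (\<Sum>i\<in>B. w i powr (-1/(p-1))) powr (p-1) * (\<Sum>i\<in>B. w i * norm (z i) powr p)"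
proof (cases "B = {}")
  case False
  define v where "v i = w i powr (-1/(p-1))" for i
  define S where "S = sum v B"
  have v: "v i > 0" if "i \<in> B" for i
    using assms(3)[OF that] by (simp add: v_def)
  have S: "S > 0"
    unfolding S_def using assms(2) False v by (intro sum_pos) auto
  have "norm (\<Sum>i\<in>B. z i) powr p \<le> (\<Sum>i\<in>B. norm (z i)) powr p"
    using assms(1) by (intro powr_mono2 norm_sum) auto
  also have "(\<Sum>i\<in>B. norm (z i)) = (\<Sum>i\<in>B. (v i / S) *\<^sub>R (S * norm (z i) / v i))"
    using v S by (intro sum.cong) (auto simp: less_imp_neq[symmetric])
  also have "\<dots> powr p \<le> (\<Sum>i\<in>B. (v i / S) * (S * norm (z i) / v i) powr p)"
  proof (rule convex_on_sum[where C = "{0..}" and f = "\<lambda>x. x powr p"])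
    show "convex_on {0..} (\<lambda>x::real. x powr p)"
      using assms(1) by (intro powr_convex_nonneg) auto
    show "(\<Sum>i\<in>B. v i / S) = 1"
      using S by (simp add: S_def flip: sum_divide_distrib)
    show "S * norm (z i) / v i \<in> {0..}" if "i \<in> B" for i
      using S v[OF that] by simp
  qed (use assms(2) False v S in \<open>auto intro: less_imp_le\<close>)
  also have "\<dots> = (\<Sum>i\<in>B. S powr (p-1) * (w i * norm (z i) powr p))"
  proof (rule sum.cong)
    fix i assume i: "i \<in> B"
    have "v i / v i powr p = v i powr (1 - p)"
      using v[OF i] by (simp add: powr_diff)
    also have "\<dots> = w i powr (-1/(p-1) * (1-p))"
      by (simp add: v_def powr_powr)
    also have "-1/(p-1) * (1-p) = 1"
      using assms(1) by (simp add: field_simps)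
    also have "w i powr 1 = w i"
      using assms(3)[OF i] by simp
    finally have 1: "v i / v i powr p = w i" .
    have 2: "S powr p / S = S powr (p-1)"
      using S by (simp add: powr_diff)
    have "(v i / S) * (S * norm (z i) / v i) powr p
            = (S powr p / S) * ((v i / v i powr p) * norm (z i) powr p)"
      using v[OF i] S by (simp add: powr_divide powr_mult)
    then show "(v i / S) * (S * norm (z i) / v i) powr p = S powr (p-1) * (w i * norm (z i) powr p)"
      by (simp only: 1 2)
  qed simp
  finally show ?thesis
    by (simp add: S_def v_def sum_distrib_left)
qed simp

text \<open>
  Otherwise \<open>S\<close> would gain a factor \<open>y\<close> on every step of length \<open>d\<close> and so grow exponentially.
\<close>

lemma polynomially_bounded_slow_growth:
  fixes S :: "nat \<Rightarrow> real"
  assumes "\<And>N. S N \<le> real N ^ n" "S 1 > 0" "y > 1"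
  shows "\<exists>N\<ge>1. S (N + d) \<le> y * S N"
proof (rule ccontr)
  assume "\<not> ?thesis"
  then have step: "y * S N \<le> S (N + d)" if "N \<ge> 1" for N
    using that by (meson le_cases)
  have lower: "y ^ k * S 1 \<le> S (1 + k * d)" for k
  proof (induction k)
    case (Suc k)
    have "y ^ Suc k * S 1 \<le> y * S (1 + k * d)"
      using Suc assms(3) by simp
    also have "\<dots> \<le> S (1 + Suc k * d)"
      using step[of "1 + k * d"] by (simp add: algebra_simps)
    finally show ?case .
  qed simp
  have "((\<lambda>k::nat. (1 + real k * real d) ^ n / y ^ k) \<longlongrightarrow> 0) at_top"
  proof (cases "d = 0")
    case True
    then show ?thesis using assms(3) by simp real_asymp
  next
    case False
    then have "real d > 0" by simp
    then show ?thesis using assms(3) by real_asymp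
  qed
  moreover have "S 1 \<le> (1 + real k * real d) ^ n / y ^ k" for k
  proof -
    have "y ^ k * S 1 \<le> (1 + real k * real d) ^ n"
      using lower[of k] assms(1)[of "1 + k * d"] by simp
    then show ?thesis using assms(3) by (simp add: field_simps)
  qed
  ultimately have "S 1 \<le> 0"
    by (intro LIMSEQ_le_const) auto
  then show False using assms(2) by simp
qed

section \<open>Commuting isometries of \<open>L\<^sup>p\<close>\<close>

lemma Lp_space_zero [simp]: "(\<lambda>_. 0) \<in> Lp_space p M"
  by (simp add: Lp_space_def)

lemma Lp_space_scale:
  assumes "f \<in> Lp_space p M"
  shows "(\<lambda>x. c * f x) \<in> Lp_space p M"
  using assms by (auto simp: Lp_space_def norm_mult powr_mult)

lemma Lp_space_add:
  assumes "0 < p" "f \<in> Lp_space p M" "g \<in> Lp_space p M"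
  shows "(\<lambda>x. f x + g x) \<in> Lp_space p M"
proof -
  have [measurable]: "f \<in> borel_measurable M" "g \<in> borel_measurable M"
    using assms by (auto simp: Lp_space_def)
  have "integrable M (\<lambda>x. norm (f x + g x) powr p)"
  proof (rule Bochner_Integration.integrable_bound)
    show "integrable M (\<lambda>x. 2 powr p * (norm (f x) powr p + norm (g x) powr p))"
      using assms by (simp add: Lp_space_def)
    have "norm (f x + g x) powr p \<le> 2 powr p * (norm (f x) powr p + norm (g x) powr p)" for x
    proof -
      have "norm (f x + g x) powr p \<le> (2 * max (norm (f x)) (norm (g x))) powr p"
        using assms(1) by (intro powr_mono2 order_trans[OF norm_triangle_ineq]) auto
      also have "\<dots> = 2 powr p * max (norm (f x)) (norm (g x)) powr p"
        by (simp add: powr_mult)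
      also have "\<dots> \<le> 2 powr p * (norm (f x) powr p + norm (g x) powr p)"
        by (intro mult_left_mono) (auto simp: max_def)
      finally show ?thesis .
    qed
    then show "AE x in M. norm (norm (f x + g x) powr p)
        \<le> norm (2 powr p * (norm (f x) powr p + norm (g x) powr p))"
      by simp
  qed simp
  then show ?thesis by (simp add: Lp_space_def)
qed

lemma Lp_space_sum:
  assumes "0 < p" "\<And>k. k \<in> A \<Longrightarrow> f k \<in> Lp_space p M"
  shows "(\<lambda>x. \<Sum>k\<in>A. c k * f k x) \<in> Lp_space p M"
  using assms(2)
  by (induction A rule: infinite_finite_induct)
     (simp_all add: Lp_space_add[OF assms(1)] Lp_space_scale)

lemma Lp_linear_isometryD:
  assumes "Lp_linear_isometry p M T" "f \<in> Lp_space p M"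
  shows "T f \<in> Lp_space p M"
    and "g \<in> Lp_space p M \<Longrightarrow> AE x in M. f x = g x \<Longrightarrow> AE x in M. T f x = T g x"
    and "g \<in> Lp_space p M \<Longrightarrow> AE x in M. T (\<lambda>y. f y + g y) x = T f x + T g x"
    and "AE x in M. T (\<lambda>y. c * f y) x = c * T f x"
    and "Lp_norm p M (T f) = Lp_norm p M f"
  using assms unfolding Lp_linear_isometry_def by blast+

lemma Lp_linear_isometry_sum:
  assumes "0 < p" and T: "Lp_linear_isometry p M T"
    and "finite A" "\<And>k. k \<in> A \<Longrightarrow> f k \<in> Lp_space p M"
  shows "AE x in M. T (\<lambda>y. \<Sum>k\<in>A. c k * f k y) x = (\<Sum>k\<in>A. c k * T (f k) x)"
  using assms(3,4)
proof (induction A rule: finite_induct)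
  case empty
  show ?case
    using Lp_linear_isometryD(4)[OF T Lp_space_zero, of 0] by simp
next
  case (insert a A)
  have a: "(\<lambda>y. c a * f a y) \<in> Lp_space p M"
    and A: "(\<lambda>y. \<Sum>k\<in>A. c k * f k y) \<in> Lp_space p M"
    using insert by (auto intro!: Lp_space_scale Lp_space_sum assms(1))
  have "AE x in M. T (\<lambda>y. \<Sum>k\<in>A. c k * f k y) x = (\<Sum>k\<in>A. c k * T (f k) x)"
    using insert by simp
  with Lp_linear_isometryD(3)[OF T a A] Lp_linear_isometryD(4)[OF T, of "f a" "c a"]
  show ?case
    using insert by auto
qed

lemma Lp_linear_isometry_integral:
  assumes "0 < p" "Lp_linear_isometry p M T" "f \<in> Lp_space p M"
  shows "(\<integral>x. norm (T f x) powr p \<partial>M) = (\<integral>x. norm (f x) powr p \<partial>M)"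
proof -
  have "(\<integral>x. norm (T f x) powr p \<partial>M) powr (1/p) = (\<integral>x. norm (f x) powr p \<partial>M) powr (1/p)"
    using Lp_linear_isometryD(5)[OF assms(2,3)] by (simp add: Lp_norm_def)
  then have "((\<integral>x. norm (T f x) powr p \<partial>M) powr (1/p)) powr p
               = ((\<integral>x. norm (f x) powr p \<partial>M) powr (1/p)) powr p"
    by simp
  then show ?thesis
    using assms(1) by (simp add: powr_powr)
qed

lemma Lp_linear_isometry_id: "Lp_linear_isometry p M id"
  by (simp add: Lp_linear_isometry_def)

lemma Lp_linear_isometry_comp:
  assumes "0 < p" and S: "Lp_linear_isometry p M S" and T: "Lp_linear_isometry p M T"
  shows "Lp_linear_isometry p M (S \<circ> T)"
  unfolding Lp_linear_isometry_def o_def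
proof (intro conjI ballI allI impI)
  fix f assume f: "f \<in> Lp_space p M"
  note Tf = Lp_linear_isometryD(1)[OF T f]
  show "S (T f) \<in> Lp_space p M"
    using Lp_linear_isometryD(1)[OF S Tf] .
  show "Lp_norm p M (S (T f)) = Lp_norm p M f"
    using Lp_linear_isometryD(5)[OF S Tf] Lp_linear_isometryD(5)[OF T f] by simp
  show "AE x in M. S (T (\<lambda>y. c * f y)) x = c * S (T f) x" for c
    using Lp_linear_isometryD(2)[OF S _ _ Lp_linear_isometryD(4)[OF T f, of c]]
      Lp_linear_isometryD(4)[OF S Tf, of c]
    by (auto simp: Lp_space_scale f Tf Lp_linear_isometryD(1)[OF T])
  fix g assume g: "g \<in> Lp_space p M"
  note Tg = Lp_linear_isometryD(1)[OF T g]
  show "AE x in M. S (T f) x = S (T g) x" if "AE x in M. f x = g x"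
    using Lp_linear_isometryD(2)[OF S Tf Tg Lp_linear_isometryD(2)[OF T f g that]] .
  show "AE x in M. S (T (\<lambda>y. f y + g y)) x = S (T f) x + S (T g) x"
    using Lp_linear_isometryD(2)[OF S _ _ Lp_linear_isometryD(3)[OF T f g]]
      Lp_linear_isometryD(3)[OF S Tf Tg]
    by (auto simp: Lp_space_add[OF assms(1)] f g Tf Tg Lp_linear_isometryD(1)[OF T])
qed

lemma Lp_linear_isometry_funpow:
  assumes "0 < p" "Lp_linear_isometry p M T"
  shows "Lp_linear_isometry p M (T ^^ k)"
proof (induction k)
  case 0
  show ?case
    unfolding funpow.simps by (rule Lp_linear_isometry_id)
next
  case (Suc k)
  then show ?case
    unfolding funpow.simps by (rule Lp_linear_isometry_comp[OF assms])
qed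

lemma Lp_commute_sym: "Lp_commute p M S T \<Longrightarrow> Lp_commute p M T S"
  unfolding Lp_commute_def by (auto simp: eq_commute)

lemma Lp_commute_comp:
  assumes R: "Lp_linear_isometry p M R" and S: "Lp_linear_isometry p M S"
    and T: "Lp_linear_isometry p M T"
    and "Lp_commute p M R S" "Lp_commute p M R T"
  shows "Lp_commute p M R (S \<circ> T)"
  unfolding Lp_commute_def o_def
proof
  fix f assume f: "f \<in> Lp_space p M"
  note D = Lp_linear_isometryD(1)
  have "AE x in M. R (S (T f)) x = S (R (T f)) x"
    using assms(4) D[OF T f] by (simp add: Lp_commute_def)
  moreover have "AE x in M. S (R (T f)) x = S (T (R f)) x"
    using assms(5) f D[OF T] D[OF R]
    by (intro Lp_linear_isometryD(2)[OF S]) (auto simp: Lp_commute_def)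
  ultimately show "AE x in M. R (S (T f)) x = S (T (R f)) x"
    by auto
qed

lemma Lp_commute_funpow:
  assumes "0 < p" "Lp_linear_isometry p M S" "Lp_linear_isometry p M T" "Lp_commute p M S T"
  shows "Lp_commute p M S (T ^^ k)"
proof (induction k)
  case 0
  show ?case by (simp add: Lp_commute_def)
next
  case (Suc k)
  then show ?case
    unfolding funpow.simps
    by (rule Lp_commute_comp[OF assms(2,3) Lp_linear_isometry_funpow[OF assms(1,3)] assms(4)])
qed

text \<open>
  The product of the powers \<open>T j ^^ e j\<close> in the order of \<open>js\<close>, which is how \<^const>\<open>monom_op\<close> is
  built; a list of indices allows induction, and exponents of type \<^typ>\<open>'i \<Rightarrow> nat\<close> can be added
  and subtracted without regard to finite support.
\<close>

definition op_power :: "('i \<Rightarrow> 'v \<Rightarrow> 'v) \<Rightarrow> 'i list \<Rightarrow> ('i \<Rightarrow> nat) \<Rightarrow> 'v \<Rightarrow> 'v" where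
  "op_power T js e = foldr (\<lambda>j S. (T j ^^ e j) \<circ> S) js id"

lemma op_power_Nil [simp]: "op_power T [] e = id"
  and op_power_Cons [simp]: "op_power T (j # js) e = (T j ^^ e j) \<circ> op_power T js e"
  by (simp_all add: op_power_def)

lemma monom_op_eq_op_power:
  "monom_op n T m = op_power T [1..<Suc n] (Poly_Mapping.lookup m)"
  by (simp add: monom_op_def op_power_def)

lemma op_power_cong:
  "(\<And>j. j \<in> set js \<Longrightarrow> e j = e' j) \<Longrightarrow> op_power T js e = op_power T js e'"
  by (induction js) auto

lemma Lp_linear_isometry_op_power:
  assumes "0 < p" "\<And>j. j \<in> set js \<Longrightarrow> Lp_linear_isometry p M (T j)"
  shows "Lp_linear_isometry p M (op_power T js e)"
  using assms(2)
  by (induction js)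
     (auto simp: assms(1) Lp_linear_isometry_id
           intro!: Lp_linear_isometry_comp Lp_linear_isometry_funpow)

lemma Lp_commute_op_power:
  assumes "0 < p" "Lp_linear_isometry p M S" "\<And>j. j \<in> set js \<Longrightarrow> Lp_linear_isometry p M (T j)"
    and "\<And>j. j \<in> set js \<Longrightarrow> Lp_commute p M S (T j)"
  shows "Lp_commute p M S (op_power T js e)"
  using assms(3,4)
proof (induction js)
  case Nil
  show ?case by (simp add: Lp_commute_def)
next
  case (Cons j js)
  show ?case
    unfolding op_power_Cons
  proof (rule Lp_commute_comp[OF assms(2)])
    show "Lp_commute p M S (T j ^^ e j)"
      using Cons.prems by (intro Lp_commute_funpow assms(1,2)) auto
    show "Lp_commute p M S (op_power T js e)"
      using Cons by auto
  qed (use Cons.prems in \<open>auto intro!: assms(1) Lp_linear_isometry_op_power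
                                Lp_linear_isometry_funpow\<close>)
qed

text \<open>
  The operators commute only up to null sets, so every exchange of factors below the outermost
  operator uses that isometries respect equality almost everywhere.
\<close>

lemma op_power_add:
  assumes "0 < p" and T: "\<And>j. j \<in> set js \<Longrightarrow> Lp_linear_isometry p M (T j)"
    and C: "\<And>j k. j \<in> set js \<Longrightarrow> k \<in> set js \<Longrightarrow> Lp_commute p M (T j) (T k)"
    and f: "f \<in> Lp_space p M"
  shows "AE x in M. op_power T js e (op_power T js e' f) x
                      = op_power T js (\<lambda>j. e j + e' j) f x"
  using T C
proof (induction js)
  case (Cons j js)
  define A where "A = T j ^^ e j"
  define A' where "A' = T j ^^ e' j"
  define B where "B = op_power T js e"
  define B' where "B' = op_power T js e'"
  have A: "Lp_linear_isometry p M A" and A': "Lp_linear_isometry p M A'"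
    using Cons.prems by (auto simp: A_def A'_def assms(1) intro!: Lp_linear_isometry_funpow)
  have B: "Lp_linear_isometry p M B" and B': "Lp_linear_isometry p M B'"
    and BB: "Lp_linear_isometry p M (op_power T js (\<lambda>j. e j + e' j))"
    using Cons.prems by (auto simp: B_def B'_def assms(1) intro!: Lp_linear_isometry_op_power)
  note D = Lp_linear_isometryD(1)
  have com: "Lp_commute p M B A'"
    unfolding A'_def B_def using Cons.prems
    by (intro Lp_commute_funpow Lp_commute_sym[OF Lp_commute_op_power]
          Lp_linear_isometry_op_power)
       (auto simp: assms(1))
  have "AE x in M. A (B (A' (B' f))) x = A (A' (B (B' f))) x"
    using com f by (intro Lp_linear_isometryD(2)[OF A]) (auto simp: Lp_commute_def D A' B B')
  moreover have "AE x in M. A (A' (B (B' f))) x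
      = A (A' (op_power T js (\<lambda>j. e j + e' j) f)) x"
  proof (intro Lp_linear_isometryD(2)[OF A] Lp_linear_isometryD(2)[OF A'] D[OF A'] D[OF B]
      D[OF B'] D[OF BB] f)
    show "AE x in M. B (B' f) x = op_power T js (\<lambda>j. e j + e' j) f x"
      using Cons by (auto simp: B_def B'_def)
  qed
  ultimately show ?case
    unfolding A_def A'_def B_def B'_def op_power_Cons funpow_add o_apply by auto
qed simp

section \<open>Polynomials in the right shifts\<close>

lemma right_shift_funpow:
  assumes "j \<in> {1..n}" "\<And>i. i \<notin> multi_index n \<Longrightarrow> x i = 0"
  shows "(right_shift n j ^^ k) x i
           = (if i \<in> multi_index n \<and> k < i j then x (i(j := i j - k)) else 0)"
proof (induction k arbitrary: i)
  case 0
  have "0 < i j" if "i \<in> multi_index n"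
    using that assms(1) by (force simp: multi_index_def dest: PiE_mem)
  with assms(2)[of i] show ?case by (cases "i \<in> multi_index n") auto
next
  case (Suc k)
  have "i(j := i j - 1) \<in> multi_index n" if "i \<in> multi_index n" "1 < i j"
    using that assms(1) unfolding multi_index_def by (auto simp: PiE_iff extensional_def)
  moreover have "(right_shift n j ^^ Suc k) x i
      = (if i \<in> multi_index n \<and> 1 < i j then (right_shift n j ^^ k) x (i(j := i j - 1)) else 0)"
    by (simp add: right_shift_def)
  moreover have "(right_shift n j ^^ k) x (i(j := i j - 1))
      = (if i(j := i j - 1) \<in> multi_index n \<and> k < i j - 1 then x (i(j := i j - Suc k)) else 0)"
    by (simp only: Suc.IH fun_upd_same fun_upd_upd diff_diff_left plus_1_eq_Suc)
  ultimately show ?case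
    by (auto simp del: funpow.simps fun_upd_apply)
qed

lemma op_power_right_shift:
  assumes "distinct js" "set js \<subseteq> {1..n}" "\<And>i. i \<notin> multi_index n \<Longrightarrow> x i = 0"
  shows "op_power (right_shift n) js e x i
           = (if i \<in> multi_index n \<and> (\<forall>j\<in>set js. e j < i j)
              then x (\<lambda>j. if j \<in> set js then i j - e j else i j) else 0)"
  using assms(1,2)
proof (induction js arbitrary: i)
  case Nil
  then show ?case using assms(3) by auto
next
  case (Cons j js)
  have IH: "op_power (right_shift n) js e x i
           = (if i \<in> multi_index n \<and> (\<forall>j\<in>set js. e j < i j)
              then x (\<lambda>j. if j \<in> set js then i j - e j else i j) else 0)" for i
    using Cons by simp
  have mem: "i(j := i j - e j) \<in> multi_index n" if "i \<in> multi_index n" "e j < i j"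
    using that Cons.prems unfolding multi_index_def by (auto simp: PiE_iff extensional_def)
  have "op_power (right_shift n) (j # js) e x i
      = (if i \<in> multi_index n \<and> e j < i j
         then op_power (right_shift n) js e x (i(j := i j - e j)) else 0)"
    unfolding op_power_Cons o_apply
    by (rule right_shift_funpow) (use Cons.prems IH in auto)
  also have "\<dots> = (if i \<in> multi_index n \<and> (\<forall>j\<in>set (j # js). e j < i j)
      then x (\<lambda>k. if k \<in> set (j # js) then i k - e k else i k) else 0)"
  proof (cases "i \<in> multi_index n \<and> e j < i j")
    case True
    have "(\<forall>k\<in>set js. e k < (i(j := i j - e j)) k) \<longleftrightarrow> (\<forall>k\<in>set js. e k < i k)"
      using Cons.prems by auto
    moreover have "(\<lambda>k. if k \<in> set js then (i(j := i j - e j)) k - e k else (i(j := i j - e j)) k)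
        = (\<lambda>k. if k \<in> set (j # js) then i k - e k else i k)"
      using Cons.prems by (auto simp: fun_eq_iff)
    ultimately show ?thesis
      using True mem by (simp add: IH)
  qed auto
  finally show ?case .
qed

lemma poly_op_right_shift:
  assumes "poly_in_vars n P" "\<And>i. i \<notin> multi_index n \<Longrightarrow> x i = 0"
  shows "poly_op n (right_shift n) P x i
    = (\<Sum>m\<in>Poly_Mapping.keys P. Poly_Mapping.lookup P m *
         (if i \<in> multi_index n \<and> (\<forall>j\<in>{1..n}. Poly_Mapping.lookup m j < i j)
          then x (\<lambda>j. i j - Poly_Mapping.lookup m j) else 0))"
  unfolding poly_op_def
proof (rule sum.cong)
  fix m assume "m \<in> Poly_Mapping.keys P"
  then have m: "Poly_Mapping.lookup m j = 0" if "j \<notin> {1..n}" for j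
    using assms(1) that by (auto simp: poly_in_vars_def subset_iff in_keys_iff)
  have js: "set [1..<Suc n] = {1..n}" by auto
  have "(\<lambda>j. if j \<in> {1..n} then i j - Poly_Mapping.lookup m j else i j)
      = (\<lambda>j. i j - Poly_Mapping.lookup m j)"
    using m by (auto simp: fun_eq_iff)
  then show "Poly_Mapping.lookup P m * monom_op n (right_shift n) m x i
    = Poly_Mapping.lookup P m *
         (if i \<in> multi_index n \<and> (\<forall>j\<in>{1..n}. Poly_Mapping.lookup m j < i j)
          then x (\<lambda>j. i j - Poly_Mapping.lookup m j) else 0)"
    unfolding monom_op_eq_op_power
    by (subst op_power_right_shift) (use assms(2) in \<open>simp_all only: js distinct_upt\<close>, auto)
qed simp

definition cube :: "nat \<Rightarrow> nat \<Rightarrow> (nat \<Rightarrow> nat) set" where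
  "cube n N = (\<Pi>\<^sub>E j\<in>{1..n}. {1..N})"

lemma finite_cube [simp]: "finite (cube n N)"
  by (simp add: cube_def finite_PiE)

lemma cube_subset_multi_index: "cube n N \<subseteq> multi_index n"
  unfolding cube_def multi_index_def by (rule PiE_mono) auto

lemma card_cube: "card (cube n N) = N ^ n"
  by (simp add: cube_def card_PiE)

text \<open>
  Truncated subtraction is inverse to translation by \<open>e\<close> exactly on the indices that the shifts
  do not send to zero.
\<close>

lemma cube_shift_iff:
  assumes "\<And>j. j \<notin> {1..n} \<Longrightarrow> e j = 0"
  shows "i \<in> multi_index n \<and> (\<forall>j\<in>{1..n}. e j < i j) \<and> (\<lambda>j. i j - e j) \<in> cube n N
    \<longleftrightarrow> (\<exists>k\<in>cube n N. i = (\<lambda>j. k j + e j))"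
proof
  assume *: "i \<in> multi_index n \<and> (\<forall>j\<in>{1..n}. e j < i j) \<and> (\<lambda>j. i j - e j) \<in> cube n N"
  have eq: "i = (\<lambda>j. (i j - e j) + e j)"
  proof
    fix j
    show "i j = (i j - e j) + e j"
    proof (cases "j \<in> {1..n}")
      case True
      with * have "e j < i j" by blast
      then show ?thesis by simp
    qed (simp add: assms)
  qed
  show "\<exists>k\<in>cube n N. i = (\<lambda>j. k j + e j)"
  proof (rule bexI[where x = "\<lambda>j. i j - e j"])
    show "i = (\<lambda>j. (i j - e j) + e j)" by (rule eq)
    show "(\<lambda>j. i j - e j) \<in> cube n N" using * by blast
  qed
next
  assume "\<exists>k\<in>cube n N. i = (\<lambda>j. k j + e j)"
  then show "i \<in> multi_index n \<and> (\<forall>j\<in>{1..n}. e j < i j) \<and> (\<lambda>j. i j - e j) \<in> cube n N"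
    using assms by (auto simp: cube_def multi_index_def PiE_iff extensional_def Suc_le_eq)
qed

lemma cube_add:
  assumes "\<And>j. j \<notin> {1..n} \<Longrightarrow> e j = 0" "\<And>j. e j \<le> d" "k \<in> cube n N"
  shows "(\<lambda>j. k j + e j) \<in> cube n (N + d)"
  using assms by (auto simp: cube_def PiE_iff extensional_def trans_le_add1 intro!: add_mono)

text \<open>
  The translate of the cube of side \<open>N\<close> by \<open>e\<close> lies in the cube of side \<open>N + d\<close>, so a finitely
  supported family is only displaced by a right shift, and none of it is lost.
\<close>

lemma sum_cube_shift:
  fixes g :: "(nat \<Rightarrow> nat) \<Rightarrow> 'b::comm_monoid_add"
  assumes "\<And>j. j \<notin> {1..n} \<Longrightarrow> e j = 0" "\<And>j. e j \<le> d"
  shows "(\<Sum>i\<in>cube n (N + d). if i \<in> multi_index n \<and> (\<forall>j\<in>{1..n}. e j < i j)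
            \<and> (\<lambda>j. i j - e j) \<in> cube n N then g (\<lambda>j. i j - e j) else 0) = (\<Sum>k\<in>cube n N. g k)"
proof -
  have "(\<Sum>i\<in>cube n (N + d). if i \<in> multi_index n \<and> (\<forall>j\<in>{1..n}. e j < i j)
            \<and> (\<lambda>j. i j - e j) \<in> cube n N then g (\<lambda>j. i j - e j) else 0)
      = (\<Sum>i\<in>cube n (N + d). if \<exists>k\<in>cube n N. i = (\<lambda>j. k j + e j) then g (\<lambda>j. i j - e j) else 0)"
    by (intro sum.cong refl if_cong cube_shift_iff assms(1))
  also have "\<dots> = (\<Sum>i\<in>{i \<in> cube n (N + d). \<exists>k\<in>cube n N. i = (\<lambda>j. k j + e j)}. g (\<lambda>j. i j - e j))"
    by (rule sum.inter_filter[symmetric]) simp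
  also have "{i \<in> cube n (N + d). \<exists>k\<in>cube n N. i = (\<lambda>j. k j + e j)} = (\<lambda>k j. k j + e j) ` cube n N"
    using cube_add[OF assms] by auto
  also have "(\<Sum>i\<in>\<dots>. g (\<lambda>j. i j - e j)) = (\<Sum>k\<in>cube n N. g k)"
    by (subst sum.reindex) (auto simp: inj_on_def fun_eq_iff)
  finally show ?thesis .
qed

lemma wlp_finite_support:
  assumes "finite B" "B \<subseteq> multi_index n" "\<And>i. i \<notin> B \<Longrightarrow> x i = 0"
  shows "x \<in> wlp_space p n w"
    and "wlp_norm p n w x = (\<Sum>i\<in>B. norm (x i) powr p * w i) powr (1/p)"
proof -
  have "(\<lambda>i. norm (x i) powr p * w i) summable_on multi_index n
      \<longleftrightarrow> (\<lambda>i. norm (x i) powr p * w i) summable_on B"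
    using assms by (intro summable_on_cong_neutral) auto
  then show "x \<in> wlp_space p n w"
    using assms by (auto simp: wlp_space_def)
  have "infsum (\<lambda>i. norm (x i) powr p * w i) (multi_index n)
      = infsum (\<lambda>i. norm (x i) powr p * w i) B"
    using assms by (intro infsum_cong_neutral) auto
  then show "wlp_norm p n w x = (\<Sum>i\<in>B. norm (x i) powr p * w i) powr (1/p)"
    using assms(1) by (simp add: wlp_norm_def)
qed

lemma op_norm_upper:
  assumes "op_norm V N T \<le> ereal C" "x \<in> V" "N x \<le> 1"
  shows "N (T x) \<le> C"
proof -
  have "ereal (N (T x)) \<le> op_norm V N T"
    unfolding op_norm_def using assms by (intro SUP_upper) auto
  then show ?thesis
    using assms(1) order_trans by fastforce
qed

text \<open>
  The operator norm bound by homogeneity, for families supported in a cube. All sums are finite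
  here, so that the inequality can be integrated term by term.
\<close>

lemma poly_right_shift_cube_bound:
  assumes "1 < p" and P: "poly_in_vars n P"
    and d: "\<And>m j. m \<in> Poly_Mapping.keys P \<Longrightarrow> Poly_Mapping.lookup m j \<le> d"
    and w: "\<And>i. i \<in> multi_index n \<Longrightarrow> 0 < w i"
    and C: "op_norm (wlp_space p n w) (wlp_norm p n w) (poly_op n (right_shift n) P) \<le> ereal C"
    and x: "\<And>i. i \<notin> cube n N \<Longrightarrow> x i = 0"
  shows "(\<Sum>i\<in>cube n (N + d). norm (poly_op n (right_shift n) P x i) powr p * w i)
           \<le> C powr p * (\<Sum>i\<in>cube n N. norm (x i) powr p * w i)"
proof -
  define R where "R = poly_op n (right_shift n) P"
  define T where "T y i = (\<Sum>m\<in>Poly_Mapping.keys P. Poly_Mapping.lookup P m *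
         (if i \<in> multi_index n \<and> (\<forall>j\<in>{1..n}. Poly_Mapping.lookup m j < i j)
          then y (\<lambda>j. i j - Poly_Mapping.lookup m j) else 0))" for y :: "(nat \<Rightarrow> nat) \<Rightarrow> complex" and i
  have R: "R y i = T y i" if "\<And>i. i \<notin> cube n N \<Longrightarrow> y i = 0" for y i
    unfolding R_def T_def
    by (rule poly_op_right_shift[OF P]) (use that cube_subset_multi_index in blast)
  have Rx: "R x i = T x i" for i
    using x by (rule R)
  define s where "s = (\<Sum>i\<in>cube n N. norm (x i) powr p * w i)"
  define t where "t = (\<Sum>i\<in>cube n (N + d). norm (R x i) powr p * w i)"
  have w': "0 < w i" if "i \<in> cube n M" for i M
    using w that cube_subset_multi_index by blast
  have s0: "0 \<le> s" and t0: "0 \<le> t"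
    unfolding s_def t_def using w' by (auto intro!: sum_nonneg simp: less_imp_le)
  have "t \<le> C powr p * s"
  proof (cases "s = 0")
    case True
    have x0: "x i = 0" for i
    proof (cases "i \<in> cube n N")
      case i: True
      then have "norm (x i) powr p * w i = 0"
        using True w' unfolding s_def by (subst (asm) sum_nonneg_eq_0_iff) (auto simp: less_imp_le)
      then show ?thesis using w'[OF i] by simp
    qed (rule x)
    have "R x i = 0" for i
      by (simp add: Rx T_def x0 cong: if_cong)
    then have "t = 0"
      by (simp add: t_def)
    then show ?thesis using True by simp
  next
    case False
    with s0 have s: "0 < s" by simp
    \<comment> \<open>Dividing by \<open>s powr (1/p)\<close> puts the family on the unit sphere.\<close>
    define c where "c = complex_of_real (s powr (-1/p))"
    have c: "norm c powr p = 1 / s"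
      unfolding c_def norm_of_real using s assms(1)
      by (simp add: powr_powr powr_minus_divide powr_divide)
    define y where "y i = c * x i" for i
    have y: "y i = 0" if "i \<notin> cube n N" for i
      using x[OF that] by (simp add: y_def)
    have "(\<Sum>i\<in>cube n N. norm (y i) powr p * w i) = 1"
      using s by (simp add: y_def norm_mult powr_mult c s_def[symmetric]
          flip: sum_divide_distrib)
    with wlp_finite_support[OF finite_cube cube_subset_multi_index y]
    have y1: "y \<in> wlp_space p n w" "wlp_norm p n w y \<le> 1"
      by simp_all
    have Ry0: "R y i = T y i" for i
      using y by (rule R)
    have Ry: "R y i = c * R x i" for i
      unfolding Rx Ry0 T_def sum_distrib_left
      by (intro sum.cong) (auto simp: y_def)
    have "R y i = 0" if i: "i \<notin> cube n (N + d)" for i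
      unfolding Ry0 T_def
    proof (intro sum.neutral ballI)
      fix m assume m: "m \<in> Poly_Mapping.keys P"
      then have m0: "Poly_Mapping.lookup m j = 0" if "j \<notin> {1..n}" for j
        using P that by (auto simp: poly_in_vars_def subset_iff in_keys_iff)
      have "\<not> (i \<in> multi_index n \<and> (\<forall>j\<in>{1..n}. Poly_Mapping.lookup m j < i j)
          \<and> (\<lambda>j. i j - Poly_Mapping.lookup m j) \<in> cube n N)"
        using i cube_add[OF m0 d[OF m]] by (subst cube_shift_iff[OF m0]) auto
      then show "Poly_Mapping.lookup P m *
         (if i \<in> multi_index n \<and> (\<forall>j\<in>{1..n}. Poly_Mapping.lookup m j < i j)
          then y (\<lambda>j. i j - Poly_Mapping.lookup m j) else 0) = 0"
        using y by auto
    qed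
    from wlp_finite_support(2)[OF finite_cube cube_subset_multi_index this]
    have "wlp_norm p n w (R y)
        = (\<Sum>i\<in>cube n (N + d). norm (R y i) powr p * w i) powr (1/p)" .
    also have "(\<Sum>i\<in>cube n (N + d). norm (R y i) powr p * w i) = t / s"
      by (simp add: Ry norm_mult powr_mult c t_def sum_divide_distrib)
    finally have "(t / s) powr (1/p) \<le> C"
      using op_norm_upper[where N = "wlp_norm p n w" and x = y, OF C y1] by (simp add: R_def)
    then have "((t / s) powr (1/p)) powr p \<le> C powr p"
      using assms(1) by (intro powr_mono2) auto
    then have "t / s \<le> C powr p"
      using assms(1) s t0 by (simp add: powr_powr)
    then show ?thesis
      using s by (simp add: field_simps)
  qed
  then show ?thesis
    by (simp add: s_def t_def R_def)
qed

section \<open>Transference\<close>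

text \<open>
  The heart of the proof. Put \<open>v = w powr (-1/(p-1))\<close> and, for a point \<open>x\<close>, let \<open>X x\<close> be the family
  \<open>i \<mapsto> v i * (U^(N-i) f) x\<close> on the cube of side \<open>N\<close>. The exponent of \<open>U\<close> decreases with \<open>i\<close>, so
  a right shift of \<open>X\<close> in direction \<open>j\<close> turns \<open>U^i X\<^sub>i\<close> into \<open>U\<^sub>j U^i X\<^sub>i\<close>, displaced by one step.
  Summation of \<open>U^i\<close> applied to the \<open>i\<close>-th component of \<open>P(R) X\<close> therefore gives
  \<open>S N * U^N P(U) f\<close> almost everywhere.

  The left side of the estimate is the \<open>p\<close>-th power of the norm of that sum, because \<open>U^N\<close> is an
  isometry. On the right, the factor \<open>S (N + d) powr (p-1)\<close> comes from Hoelder's inequality, after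
  which the isometries \<open>U^i\<close> may be removed term by term; \<open>C powr p\<close> comes from the bound for
  \<open>P(R)\<close> at each point \<open>x\<close>; and \<open>S N\<close> is the weighted norm of the coefficients, because
  \<open>v powr p * w = v\<close>.
\<close>

lemma poly_op_transference_estimate:
  fixes U :: "nat \<Rightarrow> ('a \<Rightarrow> complex) \<Rightarrow> ('a \<Rightarrow> complex)"
  assumes "1 < p"
    and U: "\<And>j. j \<in> {1..n} \<Longrightarrow> Lp_linear_isometry p M (U j)"
    and commute: "\<And>j k. j \<in> {1..n} \<Longrightarrow> k \<in> {1..n} \<Longrightarrow> Lp_commute p M (U j) (U k)"
    and w: "\<And>i. i \<in> multi_index n \<Longrightarrow> 0 < w i"
    and P: "poly_in_vars n P"
    and d: "\<And>m j. m \<in> Poly_Mapping.keys P \<Longrightarrow> Poly_Mapping.lookup m j \<le> d"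
    and C: "op_norm (wlp_space p n w) (wlp_norm p n w) (poly_op n (right_shift n) P) \<le> ereal C"
    and f: "f \<in> Lp_space p M"
    and S_def: "\<And>N. S N = (\<Sum>i\<in>cube n N. w i powr (-1/(p-1)))"
  shows "S N powr p * (\<integral>x. norm (poly_op n U P f x) powr p \<partial>M)
           \<le> S (N + d) powr (p-1) * C powr p * S N * (\<integral>x. norm (f x) powr p \<partial>M)"
proof -
  have p0: "0 < p" using assms(1) by simp
  define v where "v i = w i powr (-1/(p-1))" for i
  define V where "V = op_power U [1..<Suc n]"
  define K where "K = Poly_Mapping.keys P"
  define a where "a = Poly_Mapping.lookup P"
  have S: "S N = (\<Sum>i\<in>cube n N. v i)" for N
    by (simp add: S_def v_def)
  have S0: "0 \<le> S N" for N
    by (simp add: S v_def sum_nonneg)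
  have js: "set [1..<Suc n] = {1..n}" by auto
  have V: "Lp_linear_isometry p M (V e)" for e
    unfolding V_def by (rule Lp_linear_isometry_op_power[OF p0]) (use U in \<open>simp only: js\<close>)
  have V_add: "AE x in M. V e (V e' f) x = V (\<lambda>j. e j + e' j) f x" for e e'
    unfolding V_def by (rule op_power_add[OF p0 _ _ f]) (use U commute in \<open>simp_all only: js\<close>)
  have V_cong: "V e = V e'" if "\<And>j. j \<in> {1..n} \<Longrightarrow> e j = e' j" for e e'
    unfolding V_def by (rule op_power_cong) (use that in \<open>simp only: js\<close>)
  note V_mem = Lp_linear_isometryD(1)[OF V]
  define Q where "Q = poly_op n U P f"
  have Q_eq: "Q = (\<lambda>x. \<Sum>m\<in>K. a m * V (Poly_Mapping.lookup m) f x)"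
    by (simp add: Q_def poly_op_def K_def a_def V_def monom_op_eq_op_power del: upt_Suc)
  have Q: "Q \<in> Lp_space p M"
    unfolding Q_eq by (intro Lp_space_sum p0 V_mem f)

  define X where "X x i = (if i \<in> cube n N then v i * V (\<lambda>j. N - i j) f x else 0)" for x i
  define Y where "Y i x = poly_op n (right_shift n) P (X x) i" for i x
  define cond where "cond m i \<longleftrightarrow> i \<in> multi_index n \<and> (\<forall>j\<in>{1..n}. Poly_Mapping.lookup m j < i j)
      \<and> (\<lambda>j. i j - Poly_Mapping.lookup m j) \<in> cube n N" for m i
  define c where "c m i = a m * (if cond m i then of_real (v (\<lambda>j. i j - Poly_Mapping.lookup m j)) else 0)"
    for m i
  define g where "g m i = V (\<lambda>j. N - (i j - Poly_Mapping.lookup m j)) f" for m i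
  have Y_eq: "Y i = (\<lambda>x. \<Sum>m\<in>K. c m i * g m i x)" for i
  proof
    fix x
    show "Y i x = (\<Sum>m\<in>K. c m i * g m i x)"
      unfolding Y_def K_def
      by (subst poly_op_right_shift[OF P])
        (use cube_subset_multi_index in
          \<open>auto simp: X_def c_def g_def a_def cond_def intro!: sum.cong\<close>)
  qed
  have Y: "Y i \<in> Lp_space p M" for i
    unfolding Y_eq g_def by (intro Lp_space_sum p0 V_mem f)
  define Z where "Z i = V i (Y i)" for i
  have Z: "Z i \<in> Lp_space p M" for i
    unfolding Z_def by (intro V_mem Y)
  have Z_eq: "AE x in M. Z i x = (\<Sum>m\<in>K. c m i * V (\<lambda>j. N + Poly_Mapping.lookup m j) f x)" for i
  proof -
    have "AE x in M. V i (Y i) x = (\<Sum>m\<in>K. c m i * V i (g m i) x)"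
      unfolding Y_eq by (rule Lp_linear_isometry_sum[OF p0 V]) (auto simp: K_def g_def V_mem f)
    moreover have "AE x in M. \<forall>m\<in>K. c m i * V i (g m i) x
        = c m i * V (\<lambda>j. N + Poly_Mapping.lookup m j) f x"
    proof (rule AE_finite_allI)
      fix m assume "m \<in> K"
      show "AE x in M. c m i * V i (g m i) x = c m i * V (\<lambda>j. N + Poly_Mapping.lookup m j) f x"
      proof (cases "cond m i")
        case True
        \<comment> \<open>The truncated differences are genuine ones when the shifted index lies in the cube.\<close>
        have "V (\<lambda>j. i j + (N - (i j - Poly_Mapping.lookup m j)))
            = V (\<lambda>j. N + Poly_Mapping.lookup m j)"
        proof (rule V_cong)
          fix j assume "j \<in> {1..n}"
          with True have "Poly_Mapping.lookup m j < i j" "i j - Poly_Mapping.lookup m j \<le> N"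
            by (auto simp: cond_def cube_def PiE_iff)
          then show "i j + (N - (i j - Poly_Mapping.lookup m j)) = N + Poly_Mapping.lookup m j"
            by simp
        qed
        then show ?thesis
          using V_add[of i "\<lambda>j. N - (i j - Poly_Mapping.lookup m j)"] by (auto simp: g_def)
      qed (simp add: c_def)
    qed (simp add: K_def)
    ultimately show ?thesis
      unfolding Z_def by eventually_elim (simp cong: sum.cong)
  qed
  have c_sum: "(\<Sum>i\<in>cube n (N + d). c m i) = a m * of_real (S N)" if m: "m \<in> K" for m
  proof -
    have m0: "Poly_Mapping.lookup m j = 0" if "j \<notin> {1..n}" for j
      using P m that by (auto simp: poly_in_vars_def K_def subset_iff in_keys_iff)
    have "(\<Sum>i\<in>cube n (N + d). c m i) = a m * (\<Sum>i\<in>cube n (N + d).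
        if cond m i then of_real (v (\<lambda>j. i j - Poly_Mapping.lookup m j)) else 0)"
      by (simp add: c_def sum_distrib_left)
    also have "\<dots> = a m * (\<Sum>k\<in>cube n N. of_real (v k))"
      unfolding cond_def
      by (subst sum_cube_shift[where g = "\<lambda>k. complex_of_real (v k)"])
        (use m0 d m in \<open>auto simp: K_def\<close>)
    finally show ?thesis by (simp add: S)
  qed
  have total: "AE x in M. (\<Sum>i\<in>cube n (N + d). Z i x) = of_real (S N) * V (\<lambda>_. N) Q x"
  proof -
    have "AE x in M. \<forall>i\<in>cube n (N + d).
        Z i x = (\<Sum>m\<in>K. c m i * V (\<lambda>j. N + Poly_Mapping.lookup m j) f x)"
      by (rule AE_finite_allI) (use Z_eq in auto)
    moreover have "AE x in M. V (\<lambda>_. N) Q x = (\<Sum>m\<in>K. a m * V (\<lambda>_. N) (V (Poly_Mapping.lookup m) f) x)"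
      unfolding Q_eq by (rule Lp_linear_isometry_sum[OF p0 V]) (auto simp: K_def V_mem f)
    moreover have "AE x in M. \<forall>m\<in>K. V (\<lambda>_. N) (V (Poly_Mapping.lookup m) f) x
        = V (\<lambda>j. N + Poly_Mapping.lookup m j) f x"
      by (rule AE_finite_allI) (use V_add in \<open>auto simp: K_def\<close>)
    ultimately show ?thesis
    proof eventually_elim
      case (elim x)
      have "(\<Sum>i\<in>cube n (N + d). Z i x)
          = (\<Sum>i\<in>cube n (N + d). \<Sum>m\<in>K. c m i * V (\<lambda>j. N + Poly_Mapping.lookup m j) f x)"
        using elim(1) by (intro sum.cong) auto
      also have "\<dots> = (\<Sum>m\<in>K. (\<Sum>i\<in>cube n (N + d). c m i) * V (\<lambda>j. N + Poly_Mapping.lookup m j) f x)"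
        by (subst sum.swap) (simp add: sum_distrib_right)
      also have "\<dots> = of_real (S N) * V (\<lambda>_. N) Q x"
        using elim(2,3) by (simp add: c_sum sum_distrib_left mult_ac cong: sum.cong)
      finally show ?case .
    qed
  qed

  have int: "integrable M (\<lambda>x. norm (h x) powr p)" if "h \<in> Lp_space p M" for h
    using that by (simp add: Lp_space_def)
  note isom = Lp_linear_isometry_integral[OF p0 V]
  have w': "0 < w i" if "i \<in> cube n N" for i N
    using w that cube_subset_multi_index by blast
  have "S N powr p * (\<integral>x. norm (Q x) powr p \<partial>M)
      = (\<integral>x. norm (of_real (S N) * V (\<lambda>_. N) Q x) powr p \<partial>M)"
    using S0 by (simp add: isom[OF Q] norm_mult powr_mult)
  also have "\<dots> = (\<integral>x. norm (\<Sum>i\<in>cube n (N + d). 1 * Z i x) powr p \<partial>M)"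
  proof (rule integral_cong_AE)
    show "(\<lambda>x. norm (of_real (S N) * V (\<lambda>_. N) Q x) powr p) \<in> borel_measurable M"
      using Lp_space_scale[OF V_mem[OF Q]] by (intro borel_measurable_integrable int)
    show "(\<lambda>x. norm (\<Sum>i\<in>cube n (N + d). 1 * Z i x) powr p) \<in> borel_measurable M"
      by (intro borel_measurable_integrable int Lp_space_sum p0 Z)
    show "AE x in M. norm (of_real (S N) * V (\<lambda>_. N) Q x) powr p
        = norm (\<Sum>i\<in>cube n (N + d). 1 * Z i x) powr p"
      using total by eventually_elim simp
  qed
  also have "\<dots> \<le> (\<integral>x. S (N + d) powr (p-1) * (\<Sum>i\<in>cube n (N + d). w i * norm (Z i x) powr p) \<partial>M)"
  proof (rule integral_mono)
    show "integrable M (\<lambda>x. norm (\<Sum>i\<in>cube n (N + d). 1 * Z i x) powr p)"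
      by (intro int Lp_space_sum p0 Z)
    show "integrable M (\<lambda>x. S (N + d) powr (p-1) * (\<Sum>i\<in>cube n (N + d). w i * norm (Z i x) powr p))"
      by (intro integrable_mult_right Bochner_Integration.integrable_sum int Z)
    show "norm (\<Sum>i\<in>cube n (N + d). 1 * Z i x) powr p
        \<le> S (N + d) powr (p-1) * (\<Sum>i\<in>cube n (N + d). w i * norm (Z i x) powr p)" for x
      unfolding S_def mult_1_left by (intro weighted_Hoelder_powr assms(1) finite_cube w')
  qed
  also have "\<dots> = S (N + d) powr (p-1) * (\<Sum>i\<in>cube n (N + d). w i * (\<integral>x. norm (Y i x) powr p \<partial>M))"
    by (simp add: Bochner_Integration.integral_sum int Z Z_def isom Y V_mem)
  also have "(\<Sum>i\<in>cube n (N + d). w i * (\<integral>x. norm (Y i x) powr p \<partial>M))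
      = (\<integral>x. (\<Sum>i\<in>cube n (N + d). norm (Y i x) powr p * w i) \<partial>M)"
    by (simp add: Bochner_Integration.integral_sum int Y mult.commute)
  also have "\<dots> \<le> (\<integral>x. C powr p * (\<Sum>i\<in>cube n N. v i * norm (V (\<lambda>j. N - i j) f x) powr p) \<partial>M)"
  proof (rule integral_mono)
    show "integrable M (\<lambda>x. \<Sum>i\<in>cube n (N + d). norm (Y i x) powr p * w i)"
      by (intro integrable_mult_left Bochner_Integration.integrable_sum int Y)
    show "integrable M (\<lambda>x. C powr p * (\<Sum>i\<in>cube n N. v i * norm (V (\<lambda>j. N - i j) f x) powr p))"
      by (intro integrable_mult_right Bochner_Integration.integrable_sum int V_mem f)
    fix x
    have "(\<Sum>i\<in>cube n N. norm (X x i) powr p * w i)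
        = (\<Sum>i\<in>cube n N. v i * norm (V (\<lambda>j. N - i j) f x) powr p)"
    proof (rule sum.cong)
      fix i assume i: "i \<in> cube n N"
      have "v i powr p * w i = w i powr (-1/(p-1) * p + 1)"
        unfolding v_def powr_powr powr_add using w'[OF i] by simp
      also have "-1/(p-1) * p + 1 = -1/(p-1)"
        using assms(1) by (simp add: field_simps)
      finally have "v i powr p * w i = v i"
        by (simp add: v_def)
      moreover have "norm (X x i) powr p * w i
          = (v i powr p * w i) * norm (V (\<lambda>j. N - i j) f x) powr p"
        using i by (simp add: X_def norm_mult powr_mult v_def)
      ultimately show "norm (X x i) powr p * w i = v i * norm (V (\<lambda>j. N - i j) f x) powr p"
        by simp
    qed simp
    then show "(\<Sum>i\<in>cube n (N + d). norm (Y i x) powr p * w i)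
        \<le> C powr p * (\<Sum>i\<in>cube n N. v i * norm (V (\<lambda>j. N - i j) f x) powr p)"
      using poly_right_shift_cube_bound[OF assms(1) P d w C, of N "X x"]
      by (simp add: Y_def X_def)
  qed
  also have "\<dots> = C powr p * (S N * (\<integral>x. norm (f x) powr p \<partial>M))"
    by (simp add: Bochner_Integration.integral_sum int V_mem f isom S sum_distrib_right)
  finally have "S N powr p * (\<integral>x. norm (Q x) powr p \<partial>M)
      \<le> S (N + d) powr (p-1) * (C powr p * (S N * (\<integral>x. norm (f x) powr p \<partial>M)))"
    by (simp add: mult_left_mono)
  then show ?thesis
    by (simp add: Q_def mult_ac)
qed

lemma op_norm_poly_right_shift_nonneg:
  assumes "poly_in_vars n P"
  shows "0 \<le> op_norm (wlp_space p n w) (wlp_norm p n w) (poly_op n (right_shift n) P)"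
proof -
  have "(0::ereal) \<le> ereal (wlp_norm p n w (poly_op n (right_shift n) P (\<lambda>_. 0)))"
    by (simp add: wlp_norm_def)
  also have "\<dots> \<le> op_norm (wlp_space p n w) (wlp_norm p n w) (poly_op n (right_shift n) P)"
    unfolding op_norm_def
    by (rule SUP_upper) (simp add: wlp_space_def wlp_norm_def)
  finally show ?thesis .
qed

theorem theorem1p4:
  fixes p :: real and n :: nat and M :: "'a measure"
    and U :: "nat \<Rightarrow> ('a \<Rightarrow> complex) \<Rightarrow> ('a \<Rightarrow> complex)"
    and w :: "(nat \<Rightarrow> nat) \<Rightarrow> real"
    and P :: cmpoly
  assumes "1 < p" and "n \<ge> 1"
    and "sigma_finite_measure M"
    and "\<And>j. j \<in> {1..n} \<Longrightarrow> Lp_linear_isometry p M (U j)"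
    and "\<And>j k. j \<in> {1..n} \<Longrightarrow> k \<in> {1..n} \<Longrightarrow> Lp_commute p M (U j) (U k)"
    and "\<And>i. i \<in> multi_index n \<Longrightarrow> w i > 0"
    and "\<And>i. i \<in> multi_index n \<Longrightarrow> w i \<ge> 1"
    and "\<And>j. j \<in> {1..n} \<Longrightarrow>
           (SUP i\<in>multi_index n. ereal (w (i(j := i j + 1)) / w i)) < \<infinity>"
    and "poly_in_vars n P"
  shows "op_norm (Lp_space p M) (Lp_norm p M) (poly_op n U P)
           \<le> op_norm (wlp_space p n w) (wlp_norm p n w) (poly_op n (right_shift n) P)"
proof (cases "op_norm (wlp_space p n w) (wlp_norm p n w) (poly_op n (right_shift n) P)")
  case (real C)
  have C0: "0 \<le> C"
    using op_norm_poly_right_shift_nonneg[OF assms(9), of p w] real by simp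
  define d where "d = (\<Sum>m\<in>Poly_Mapping.keys P. \<Sum>j\<in>Poly_Mapping.keys m. Poly_Mapping.lookup m j)"
  have d: "Poly_Mapping.lookup m j \<le> d" if "m \<in> Poly_Mapping.keys P" for m j
  proof (cases "j \<in> Poly_Mapping.keys m")
    case True
    then have "Poly_Mapping.lookup m j \<le> (\<Sum>j\<in>Poly_Mapping.keys m. Poly_Mapping.lookup m j)"
      by (intro member_le_sum) auto
    also have "\<dots> \<le> d"
      unfolding d_def using that
      by (intro member_le_sum[where f = "\<lambda>m. \<Sum>j\<in>Poly_Mapping.keys m. Poly_Mapping.lookup m j"]) auto
    finally show ?thesis .
  qed (simp add: in_keys_iff)
  define S where "S N = (\<Sum>i\<in>cube n N. w i powr (-1/(p-1)))" for N
  have w: "0 < w i" "1 \<le> w i" if "i \<in> cube n N" for i N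
    using assms(6,7) that cube_subset_multi_index by blast+
  have S_le: "S N \<le> real N ^ n" for N
  proof -
    have "S N \<le> (\<Sum>i\<in>cube n N. 1)"
      unfolding S_def
    proof (rule sum_mono)
      fix i assume "i \<in> cube n N"
      then have "w i powr (-1/(p-1)) \<le> w i powr 0"
        using w(2) assms(1) by (intro powr_mono) auto
      then show "w i powr (-1/(p-1)) \<le> 1"
        using w(1)[OF \<open>i \<in> cube n N\<close>] by simp
    qed
    then show ?thesis by (simp add: card_cube)
  qed
  have S_pos: "0 < S N" if "1 \<le> N" for N
  proof -
    have "cube n N \<noteq> {}"
      using that by (simp add: cube_def PiE_eq_empty_iff)
    then show ?thesis
      unfolding S_def using w(1) by (intro sum_pos) (auto simp: less_imp_neq[symmetric])
  qed
  have "Lp_norm p M (poly_op n U P f) \<le> C"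
    if f: "f \<in> Lp_space p M" "Lp_norm p M f \<le> 1" for f
  proof -
    define A where "A = (\<integral>x. norm (poly_op n U P f x) powr p \<partial>M)"
    define F where "F = (\<integral>x. norm (f x) powr p \<partial>M)"
    have A0: "0 \<le> A" and F0: "0 \<le> F"
      by (simp_all add: A_def F_def)
    have "F = (F powr (1/p)) powr p"
      using F0 assms(1) by (simp add: powr_powr)
    also have "\<dots> \<le> 1 powr p"
      using f(2) assms(1) by (intro powr_mono2) (auto simp: Lp_norm_def F_def)
    finally have F1: "F \<le> 1" by simp
    have "z * A \<le> C powr p" if z: "0 < z" "z < 1" for z
    proof -
      \<comment> \<open>The factor for which \<open>y powr (p-1)\<close>, the loss in the estimate, is \<open>1/z\<close>.\<close>
      define y where "y = (1/z) powr (1/(p-1))"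
      have y: "1 < y"
        unfolding y_def using z assms(1) by (intro gr_one_powr) auto
      obtain N where N: "1 \<le> N" "S (N + d) \<le> y * S N"
        using polynomially_bounded_slow_growth[of S n y d] S_le S_pos y by auto
      have "S N powr p * A \<le> S (N + d) powr (p-1) * C powr p * S N * F"
        unfolding A_def F_def
        by (rule poly_op_transference_estimate[OF assms(1,4,5,6,9) d _ f(1) S_def])
           (simp_all add: real)
      also have "\<dots> \<le> S (N + d) powr (p-1) * C powr p * S N * 1"
        using F1 S_pos[OF N(1)] by (intro mult_left_mono) auto
      also have "\<dots> \<le> (y * S N) powr (p-1) * C powr p * S N * 1"
        using N S_pos[of "N + d"] S_pos[of N] assms(1)
        by (intro mult_right_mono powr_mono2) auto
      also have "\<dots> = (S N powr (p-1) * S N) * (y powr (p-1) * C powr p)"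
        by (simp add: powr_mult)
      also have "S N powr (p-1) * S N = S N powr p"
        using S_pos[OF N(1)] by (simp add: powr_diff)
      also have "y powr (p-1) = 1/z"
        using z assms(1) by (simp add: y_def powr_powr)
      finally have "S N powr p * A \<le> S N powr p * (1/z * C powr p)" .
      then have "A \<le> 1/z * C powr p"
        by (rule mult_left_le_imp_le) (use S_pos[OF N(1)] in simp)
      then show ?thesis
        using z by (simp add: field_simps)
    qed
    then have "A \<le> C powr p"
      by (rule field_le_mult_one_interval)
    then have "A powr (1/p) \<le> (C powr p) powr (1/p)"
      using A0 assms(1) by (intro powr_mono2) auto
    also have "\<dots> = C"
      using C0 assms(1) by (simp add: powr_powr)
    finally show ?thesis
      by (simp add: Lp_norm_def A_def)
  qed
  then show ?thesis
    unfolding real by (auto simp: op_norm_def intro!: SUP_least)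
next
  case PInf
  then show ?thesis by simp
next
  case MInf
  with op_norm_poly_right_shift_nonneg[OF assms(9), of p w] show ?thesis by simp
qed

end
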